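(* Let $0 \ne \alpha = a + bi \in \mathbb{Z}[i]$ with integers $a, b \ge 0$, and let $0 \ne \beta \in \mathbb{Z}[i]$ be such that $N(\alpha) \ge 5$ and $\beta$ divides $\alpha$. Let $t$ be an integer with $1 \le t \le \lfloor (a+b-1)/2 \rfloor$. Then $(\beta)/(\alpha)$ is a perfect $t$-code in the Gaussian network $G_\alpha$ if and only if $\beta$ is an associate of $t + (t+1)i$ or of $t - (t+1)i$.
   Context: $\mathbb{Z}[i]$ is the ring of Gaussian integers with norm $N(x+yi) = x^2+y^2$; two elements are associates if one is $i^j$ times the other for some integer $j$. The Gaussian network $G_\alpha$ is the Cayley graph on the additive group of $\mathbb{Z}[i]/(\alpha)$ with connection set $\{\pm(1 + (\alpha)), \pm(i + (\alpha))\}$, i.e. $x,y$ are adjacent iff $x - y$ lies in this set. $(\beta)/(\alpha) = \{\gamma + (\alpha) : \gamma \in (\beta)\}$. A perfect $t$-code in a graph is a nonempty vertex subset $C$ such that the balls of radius $t$ (in graph distance) centred at the vertices of $C$ partition the vertex set. *)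

theory Defs
  imports
    Complex_Main
    "HOL-Algebra.QuotRing"
    "HOL-Algebra.Divisibility"
    "HOL-Library.Disjoint_Sets"
    "Graph_Theory.Graph_Theory"
begin

section \<open>Gaussian integers\<close>

definition gauss_ring :: "complex ring" where
  "gauss_ring =
     \<lparr> carrier = {of_int x + of_int y * \<i> | x y :: int. True},
       monoid.mult = (*), one = 1, zero = 0, add = (+) \<rparr>"

definition gauss_norm :: "complex \<Rightarrow> real" where
  "gauss_norm z = (Re z)\<^sup>2 + (Im z)\<^sup>2"

definition gauss_assoc :: "complex \<Rightarrow> complex \<Rightarrow> bool" where
  "gauss_assoc x y \<longleftrightarrow> (\<exists>j :: int. x = \<i> powi j * y)"

lemma cring_gauss_ring: "cring gauss_ring"
proof (rule cringI)
  show "abelian_group gauss_ring"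
  proof (rule abelian_groupI)
    fix x y assume "x \<in> carrier gauss_ring" "y \<in> carrier gauss_ring"
    then obtain a b c d :: int
      where "x = of_int a + of_int b * \<i>" "y = of_int c + of_int d * \<i>"
      by (auto simp: gauss_ring_def)
    then have "x + y = of_int (a + c) + of_int (b + d) * \<i>"
      by (simp add: algebra_simps)
    then show "x \<oplus>\<^bsub>gauss_ring\<^esub> y \<in> carrier gauss_ring"
      by (auto simp: gauss_ring_def simp del: of_int_add)
  next
    show "\<zero>\<^bsub>gauss_ring\<^esub> \<in> carrier gauss_ring"
      by (auto simp: gauss_ring_def intro!: exI[of _ "0 :: int"])
  next
    fix x assume "x \<in> carrier gauss_ring"
    then obtain a b :: int where "x = of_int a + of_int b * \<i>"
      by (auto simp: gauss_ring_def)
    then have "of_int (- a) + of_int (- b) * \<i> + x = 0"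
      by simp
    then show "\<exists>y\<in>carrier gauss_ring. y \<oplus>\<^bsub>gauss_ring\<^esub> x = \<zero>\<^bsub>gauss_ring\<^esub>"
      unfolding gauss_ring_def by (simp del: of_int_minus) blast
  qed (auto simp: gauss_ring_def)
  show "comm_monoid gauss_ring"
  proof (rule comm_monoidI)
    fix x y assume "x \<in> carrier gauss_ring" "y \<in> carrier gauss_ring"
    then obtain a b c d :: int
      where "x = of_int a + of_int b * \<i>" "y = of_int c + of_int d * \<i>"
      by (auto simp: gauss_ring_def)
    then have "x * y = of_int (a * c - b * d) + of_int (a * d + b * c) * \<i>"
      by (simp add: complex_eq_iff)
    then show "x \<otimes>\<^bsub>gauss_ring\<^esub> y \<in> carrier gauss_ring"
      by (auto simp: gauss_ring_def simp del: of_int_add of_int_mult of_int_diff)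
  next
    have "1 = of_int 1 + of_int 0 * \<i>" by simp
    then show "\<one>\<^bsub>gauss_ring\<^esub> \<in> carrier gauss_ring"
      unfolding gauss_ring_def by (simp del: of_int_1 of_int_0) blast
  qed (auto simp: gauss_ring_def)
qed (auto simp: gauss_ring_def algebra_simps)


section \<open>Graph distance and perfect codes\<close>

text \<open>
  An undirected graph is represented by the digraph that has both orientations of every edge.
  With unit weights, the library's shortest-path cost \<open>\<mu>\<close> is the graph distance; it is
  \<open>\<infinity>\<close> between vertices that no walk connects.
\<close>

definition graph_dist :: "('a, 'b) pre_digraph \<Rightarrow> 'a \<Rightarrow> 'a \<Rightarrow> ereal" where
  "graph_dist G u v = wf_digraph.\<mu> G (\<lambda>_. 1) u v"

definition graph_ball :: "('a, 'b) pre_digraph \<Rightarrow> nat \<Rightarrow> 'a \<Rightarrow> 'a set" where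
  "graph_ball G t c = {v \<in> verts G. graph_dist G c v \<le> ereal (real t)}"

definition perfect_code :: "('a, 'b) pre_digraph \<Rightarrow> nat \<Rightarrow> 'a set \<Rightarrow> bool" where
  "perfect_code G t C \<longleftrightarrow>
     C \<noteq> {} \<and> C \<subseteq> verts G \<and>
     disjoint_family_on (graph_ball G t) C \<and>
     (\<Union>c\<in>C. graph_ball G t c) = verts G"


section \<open>Gaussian networks\<close>

definition cayley_graph :: "('a, 'm) monoid_scheme \<Rightarrow> 'a set \<Rightarrow> 'a pair_pre_digraph" where
  "cayley_graph G S =
     \<lparr> pverts = carrier G,
       parcs = {(x, y). x \<in> carrier G \<and> y \<in> carrier G \<and> x \<otimes>\<^bsub>G\<^esub> inv\<^bsub>G\<^esub> y \<in> S} \<rparr>"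

lemma wf_digraph_cayley_graph: "wf_digraph (with_proj (cayley_graph G S))"
  by (unfold_locales) (auto simp: cayley_graph_def)

abbreviation gauss_quot :: "complex \<Rightarrow> complex set ring" where
  "gauss_quot \<alpha> \<equiv> gauss_ring Quot (PIdl\<^bsub>gauss_ring\<^esub> \<alpha>)"

definition gauss_class :: "complex \<Rightarrow> complex \<Rightarrow> complex set" where
  "gauss_class \<alpha> \<gamma> = PIdl\<^bsub>gauss_ring\<^esub> \<alpha> +>\<^bsub>gauss_ring\<^esub> \<gamma>"

definition gauss_network :: "complex \<Rightarrow> (complex set, complex set \<times> complex set) pre_digraph" where
  "gauss_network \<alpha> =
     with_proj (cayley_graph (add_monoid (gauss_quot \<alpha>))
       {gauss_class \<alpha> 1, \<ominus>\<^bsub>gauss_quot \<alpha>\<^esub> gauss_class \<alpha> 1,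
        gauss_class \<alpha> \<i>, \<ominus>\<^bsub>gauss_quot \<alpha>\<^esub> gauss_class \<alpha> \<i>})"

definition ideal_quot :: "complex \<Rightarrow> complex \<Rightarrow> complex set set" where
  "ideal_quot \<beta> \<alpha> = gauss_class \<alpha> ` (PIdl\<^bsub>gauss_ring\<^esub> \<beta>)"

end

theory Submission
  imports Defs
begin

text \<open>
  The ball of radius \<open>t\<close> about a residue class is the image of a translate of the ball \<open>D\<^sub>t\<close> of the
  norm \<open>\<bar>Re z\<bar> + \<bar>Im z\<bar>\<close>, and \<open>D\<^sub>t\<close> embeds in the quotient because nonzero multiples of
  \<open>\<alpha>\<close> have norm at least \<open>a + b > 2 t\<close>. So the question is when the translates of \<open>D\<^sub>t\<close> by
  \<open>(\<beta>)\<close> tile the Gaussian integers, with \<open>\<beta> = c + d \<i>\<close>. Disjointness forces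
  \<open>\<bar>c\<bar> + \<bar>d\<bar> \<ge> 2 t + 1\<close>; covering the neighbourhood of the deep hole \<open>\<beta> (1 + \<i>) / 2\<close>
  forces \<open>max \<bar>c\<bar> \<bar>d\<bar> \<le> t + 1\<close>, and \<open>\<le> t\<close> if \<open>c + d\<close> is even. Together these leave only
  \<open>{\<bar>c\<bar>, \<bar>d\<bar>} = {t, t + 1}\<close>. Conversely, for such \<open>\<beta>\<close> any point outside \<open>D\<^sub>t\<close> gets
  shorter on subtracting a suitable associate of \<open>\<beta>\<close>.
\<close>

section \<open>Divisibility and residue classes of Gaussian integers\<close>

abbreviation gauss_ints :: "complex set" where
  "gauss_ints \<equiv> carrier gauss_ring"

abbreviation gauss_dvd :: "complex \<Rightarrow> complex \<Rightarrow> bool"  (infix \<open>dvd\<^sub>g\<close> 50) where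
  "x dvd\<^sub>g y \<equiv> x divides\<^bsub>gauss_ring\<^esub> y"

text \<open>On Gaussian integers this is the word length in the units 1, -1, \<i>, -\<i>, hence the
  graph distance from 0 in the square grid that covers the network.\<close>

definition l1 :: "complex \<Rightarrow> real" where
  "l1 z = \<bar>Re z\<bar> + \<bar>Im z\<bar>"

interpretation GI: cring gauss_ring
  by (rule cring_gauss_ring)

lemma gauss_ring_simps [simp]:
  "x \<otimes>\<^bsub>gauss_ring\<^esub> y = x * y" "x \<oplus>\<^bsub>gauss_ring\<^esub> y = x + y"
  "\<one>\<^bsub>gauss_ring\<^esub> = 1" "\<zero>\<^bsub>gauss_ring\<^esub> = 0"
  by (simp_all add: gauss_ring_def)

lemma gauss_ints_iff: "z \<in> gauss_ints \<longleftrightarrow> Re z \<in> \<int> \<and> Im z \<in> \<int>"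
proof
  assume "Re z \<in> \<int> \<and> Im z \<in> \<int>"
  then obtain x y where "Re z = of_int x" "Im z = of_int y"
    by (auto elim!: Ints_cases)
  then show "z \<in> gauss_ints"
    by (auto simp: gauss_ring_def complex_eq_iff intro!: exI[of _ x] exI[of _ y])
qed (auto simp: gauss_ring_def)

lemma gauss_ints_cases:
  assumes "z \<in> gauss_ints"
  obtains x y :: int where "z = Complex (of_int x) (of_int y)"
  using assms by (auto simp: gauss_ints_iff complex_eq_iff elim!: Ints_cases)

lemma Complex_of_int_gauss_ints [simp]: "Complex (of_int x) (of_int y) \<in> gauss_ints"
  by (simp add: gauss_ints_iff)

lemma gauss_ints_closed [simp, intro]:
  assumes "x \<in> gauss_ints" "y \<in> gauss_ints"
  shows "x + y \<in> gauss_ints" "x - y \<in> gauss_ints" "x * y \<in> gauss_ints"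
  using assms by (auto simp: gauss_ints_iff)

lemma gauss_ints_units [simp]:
  "0 \<in> gauss_ints" "1 \<in> gauss_ints" "- 1 \<in> gauss_ints" "\<i> \<in> gauss_ints" "- \<i> \<in> gauss_ints"
  by (auto simp: gauss_ints_iff)

lemma gauss_ints_uminus [simp]: "x \<in> gauss_ints \<Longrightarrow> - x \<in> gauss_ints"
  by (simp add: gauss_ints_iff)

lemma gauss_a_inv [simp]:
  assumes "x \<in> gauss_ints"
  shows "\<ominus>\<^bsub>gauss_ring\<^esub> x = - x"
  using assms GI.minus_equality[of "- x" x] by simp

lemma gauss_minus [simp]:
  assumes "x \<in> gauss_ints" "y \<in> gauss_ints"
  shows "x \<ominus>\<^bsub>gauss_ring\<^esub> y = x - y"
  using assms by (simp add: a_minus_def)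

lemma gauss_dvd_iff: "x dvd\<^sub>g y \<longleftrightarrow> (\<exists>m\<in>gauss_ints. y = x * m)"
  by (simp add: factor_def)

lemma gauss_dvd_add:
  assumes "x dvd\<^sub>g y" "x dvd\<^sub>g z"
  shows "x dvd\<^sub>g y + z"
  using assms by (auto simp: gauss_dvd_iff simp flip: distrib_left)

lemma gauss_dvd_uminus:
  assumes "x dvd\<^sub>g y"
  shows "x dvd\<^sub>g - y"
proof -
  obtain m where "m \<in> gauss_ints" "y = x * m"
    using assms by (auto simp: gauss_dvd_iff)
  then show ?thesis
    by (auto simp: gauss_dvd_iff intro!: bexI[of _ "- m"])
qed

lemma gauss_dvd_trans:
  assumes "x dvd\<^sub>g y" "y dvd\<^sub>g z"
  shows "x dvd\<^sub>g z"
  using assms by (force simp: gauss_dvd_iff mult.assoc)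

lemma cgenideal_gauss_ring:
  assumes "x \<in> gauss_ints"
  shows "PIdl\<^bsub>gauss_ring\<^esub> x = {z \<in> gauss_ints. x dvd\<^sub>g z}"
  using assms by (auto simp: cgenideal_def gauss_dvd_iff mult.commute)

lemma gauss_class_eq_iff:
  assumes "\<alpha> \<in> gauss_ints" "x \<in> gauss_ints" "y \<in> gauss_ints"
  shows "gauss_class \<alpha> x = gauss_class \<alpha> y \<longleftrightarrow> \<alpha> dvd\<^sub>g x - y"
  using GI.quotient_eq_iff_same_a_r_cos[OF GI.cgenideal_ideal[OF assms(1)] assms(2,3)] assms
  by (simp add: gauss_class_def cgenideal_gauss_ring)

lemma verts_gauss_network: "verts (gauss_network \<alpha>) = gauss_class \<alpha> ` gauss_ints"
  by (auto simp: gauss_network_def cayley_graph_def FactRing_def A_RCOSETS_def' gauss_class_def)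

text \<open>The quotient map is a ring homomorphism, so the arc condition can be read off
  representatives. The resulting form, a step by a unit, is what lifting walks to the grid
  requires.\<close>

lemma gauss_class_arc_iff:
  assumes \<alpha>: "\<alpha> \<in> gauss_ints" and x: "x \<in> gauss_ints" and y: "y \<in> gauss_ints"
  shows "(gauss_class \<alpha> x, gauss_class \<alpha> y) \<in> arcs (gauss_network \<alpha>) \<longleftrightarrow>
    (\<exists>u\<in>{1, -1, \<i>, -\<i>}. gauss_class \<alpha> y = gauss_class \<alpha> (x + u))"
proof -
  interpret I: ideal "PIdl\<^bsub>gauss_ring\<^esub> \<alpha>" gauss_ring
    using \<alpha> by (rule GI.cgenideal_ideal)
  interpret h: ring_hom_ring gauss_ring "gauss_quot \<alpha>" "gauss_class \<alpha>"
    using I.rcos_ring_hom_ring by (simp add: gauss_class_def[abs_def])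
  have neg: "\<ominus>\<^bsub>gauss_quot \<alpha>\<^esub> gauss_class \<alpha> z = gauss_class \<alpha> (- z)" if "z \<in> gauss_ints" for z
    using h.hom_a_inv[of z] that by simp
  have diff: "gauss_class \<alpha> x \<otimes>\<^bsub>add_monoid (gauss_quot \<alpha>)\<^esub>
      inv\<^bsub>add_monoid (gauss_quot \<alpha>)\<^esub> gauss_class \<alpha> y = gauss_class \<alpha> (x - y)"
    using h.hom_add[of x "- y"] neg[OF y] x y by (simp add: a_inv_def)
  have carr: "gauss_class \<alpha> x \<in> carrier (gauss_quot \<alpha>)"
    "gauss_class \<alpha> y \<in> carrier (gauss_quot \<alpha>)"
    using h.hom_closed x y by auto
  have eq: "gauss_class \<alpha> (x - y) = gauss_class \<alpha> u \<longleftrightarrow> gauss_class \<alpha> y = gauss_class \<alpha> (x + - u)"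
    if u: "u \<in> gauss_ints" for u
  proof -
    have "gauss_class \<alpha> (x - y) = gauss_class \<alpha> u \<longleftrightarrow> \<alpha> dvd\<^sub>g (x - y) - u"
      using assms u by (intro gauss_class_eq_iff) auto
    also have "\<dots> \<longleftrightarrow> \<alpha> dvd\<^sub>g y - (x + - u)"
      using gauss_dvd_uminus[of \<alpha> "(x - y) - u"] gauss_dvd_uminus[of \<alpha> "y - (x + - u)"]
      by (auto simp: algebra_simps)
    also have "\<dots> \<longleftrightarrow> gauss_class \<alpha> y = gauss_class \<alpha> (x + - u)"
      using assms u by (intro gauss_class_eq_iff[symmetric]) auto
    finally show ?thesis .
  qed
  have "(gauss_class \<alpha> x, gauss_class \<alpha> y) \<in> arcs (gauss_network \<alpha>) \<longleftrightarrow>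
      gauss_class \<alpha> (x - y) \<in> {gauss_class \<alpha> 1, gauss_class \<alpha> (- 1), gauss_class \<alpha> \<i>, gauss_class \<alpha> (- \<i>)}"
    using carr diff neg[of 1] neg[of \<i>] by (simp add: gauss_network_def cayley_graph_def)
  \<comment> \<open>Negation permutes the four units; reindexing by it turns the difference
    \<open>x - y\<close> into a move from \<open>x\<close> to \<open>y\<close>.\<close>
  also have "\<dots> \<longleftrightarrow> (\<exists>u\<in>{1, -1, \<i>, -\<i>}. gauss_class \<alpha> (x - y) = gauss_class \<alpha> (- u))"
    by (simp only: bex_simps insert_iff empty_iff minus_minus) blast
  also have "\<dots> \<longleftrightarrow> (\<exists>u\<in>{1, -1, \<i>, -\<i>}. gauss_class \<alpha> y = gauss_class \<alpha> (x + u))"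
  proof (intro bex_cong refl)
    fix u assume "u \<in> {1, -1, \<i>, -\<i>}"
    then have "- u \<in> gauss_ints"
      by auto
    from eq[OF this] show "gauss_class \<alpha> (x - y) = gauss_class \<alpha> (- u) \<longleftrightarrow>
        gauss_class \<alpha> y = gauss_class \<alpha> (x + u)"
      by simp
  qed
  finally show ?thesis .
qed

section \<open>The norm \<open>l1\<close> and balls in the Gaussian network\<close>

lemma l1_triangle: "l1 (x + y) \<le> l1 x + l1 y"
  by (simp add: l1_def)

lemma l1_triangle_diff: "l1 (x - y) \<le> l1 x + l1 y"
  by (simp add: l1_def)

lemma l1_unit: "u \<in> {1, -1, \<i>, -\<i>} \<Longrightarrow> l1 u = 1"
  by (auto simp: l1_def)

text \<open>Step towards 0 along a nonzero coordinate. The exact drop by 1 drives the inductions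
  that build walks and split long differences.\<close>

lemma l1_unit_step:
  assumes "z \<in> gauss_ints" "z \<noteq> 0"
  obtains u where "u \<in> {1, -1, \<i>, -\<i>}" "l1 (z - u) = l1 z - 1"
proof -
  from assms(1) obtain x y where z: "z = Complex (of_int x) (of_int y)"
    by (rule gauss_ints_cases)
  consider "x \<ge> 1" | "x \<le> -1" | "y \<ge> 1" | "y \<le> -1"
    using assms(2) z by (cases "x = 0"; cases "y = 0") (auto simp: complex_eq_iff, linarith+)
  then show thesis
  proof cases
    case 1
    then show ?thesis by (intro that[of 1]) (auto simp: z l1_def)
  next
    case 2
    then show ?thesis by (intro that[of "-1"]) (auto simp: z l1_def)
  next
    case 3
    then show ?thesis by (intro that[of \<i>]) (auto simp: z l1_def)
  next
    case 4
    then show ?thesis by (intro that[of "-\<i>"]) (auto simp: z l1_def)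
  qed
qed

lemma graph_dist_le_iff:
  assumes "wf_digraph G"
  shows "graph_dist G u v \<le> ereal (real t) \<longleftrightarrow>
    (\<exists>p. pre_digraph.awalk G u p v \<and> length p \<le> t)"
proof -
  interpret wf_digraph G by fact
  have cost: "awalk_cost (\<lambda>_. 1) p = real (length p)" for p
    by (induction p) (auto)
  show ?thesis
  proof
    assume "graph_dist G u v \<le> ereal (real t)"
    \<comment> \<open>An infimum yields a walk only below a strict bound; as lengths are integers,
      passing to \<open>t + 1\<close> loses nothing.\<close>
    also have "\<dots> < ereal (real t + 1)"
      by simp
    finally obtain p where "awalk u p v" "real (length p) < real t + 1"
      unfolding graph_dist_def \<mu>_def by (auto simp: INF_less_iff cost)
    then show "\<exists>p. awalk u p v \<and> length p \<le> t"
      by (intro exI[of _ p]) auto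
  next
    assume "\<exists>p. awalk u p v \<and> length p \<le> t"
    then obtain p where p: "awalk u p v" "length p \<le> t"
      by blast
    have "graph_dist G u v \<le> ereal (real (length p))"
      unfolding graph_dist_def using min_cost_le_walk_cost[OF p(1), of "\<lambda>_. 1"] by (simp add: cost)
    also have "\<dots> \<le> ereal (real t)"
      using p by simp
    finally show "graph_dist G u v \<le> ereal (real t)" .
  qed
qed

lemma wf_digraph_gauss_network: "wf_digraph (gauss_network \<alpha>)"
  unfolding gauss_network_def by (rule wf_digraph_cayley_graph)

lemma tail_head_gauss_network [simp]:
  "tail (gauss_network \<alpha>) = fst" "head (gauss_network \<alpha>) = snd"
  by (simp_all add: gauss_network_def)

text \<open>Lift the walk to the grid: each arc adds a unit to the current representative, and the
  triangle inequality bounds the sum of these units. The representative \<open>x\<close> varies in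
  the induction because the lifted start moves.\<close>

lemma gauss_network_walk_shift:
  assumes \<alpha>: "\<alpha> \<in> gauss_ints"
    and "pre_digraph.awalk (gauss_network \<alpha>) (gauss_class \<alpha> x) p v" "x \<in> gauss_ints"
  shows "\<exists>d\<in>gauss_ints. l1 d \<le> length p \<and> v = gauss_class \<alpha> (x + d)"
  using assms(2,3)
proof (induction p arbitrary: x)
  interpret wf_digraph "gauss_network \<alpha>"
    by (rule wf_digraph_gauss_network)
  {
    case Nil
    then show ?case
      by (auto simp: awalk_Nil_iff l1_def intro!: bexI[of _ 0])
  next
    case (Cons e p)
    then have arc: "e \<in> arcs (gauss_network \<alpha>)" and e: "fst e = gauss_class \<alpha> x"
      and walk: "awalk (snd e) p v"
      by (auto simp: awalk_Cons_iff)
    have "snd e \<in> verts (gauss_network \<alpha>)"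
      using head_in_verts[OF arc] by simp
    then obtain y where y: "y \<in> gauss_ints" "snd e = gauss_class \<alpha> y"
      by (auto simp: verts_gauss_network)
    then have "(gauss_class \<alpha> x, gauss_class \<alpha> y) \<in> arcs (gauss_network \<alpha>)"
      using arc e by (metis prod.collapse)
    then obtain u where u: "u \<in> {1, -1, \<i>, -\<i>}" "snd e = gauss_class \<alpha> (x + u)"
      using gauss_class_arc_iff[OF \<alpha> Cons.prems(2) y(1)] y(2) by metis
    then have ui: "u \<in> gauss_ints"
      by auto
    then obtain d where d: "d \<in> gauss_ints" "l1 d \<le> length p" "v = gauss_class \<alpha> (x + u + d)"
      using Cons.IH[of "x + u"] walk u Cons.prems(2) by auto
    show ?case
    proof (intro bexI conjI)
      show "l1 (u + d) \<le> length (e # p)"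
        using d(2) l1_triangle[of u d] l1_unit[OF u(1)] by simp
      show "v = gauss_class \<alpha> (x + (u + d))"
        using d(3) by (simp add: add.assoc)
    qed (use d ui in simp)
  }
qed

text \<open>Project a shortest grid path, built by splitting units off \<open>d\<close>. As
  \<open>n\<close> only bounds the length, the walk may stop as soon as \<open>d\<close> is
  0.\<close>

lemma gauss_network_walk_exists:
  assumes \<alpha>: "\<alpha> \<in> gauss_ints"
    and "x \<in> gauss_ints" "d \<in> gauss_ints" "l1 d \<le> real n"
  shows "\<exists>p. pre_digraph.awalk (gauss_network \<alpha>) (gauss_class \<alpha> x) p (gauss_class \<alpha> (x + d))
    \<and> length p \<le> n"
  using assms(2-4)
proof (induction n arbitrary: x d)
  interpret wf_digraph "gauss_network \<alpha>"
    by (rule wf_digraph_gauss_network)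
  {
    case 0
    then have "d = 0"
      unfolding l1_def complex_eq_iff by simp linarith
    then show ?case
      using 0 by (auto simp: awalk_Nil_iff verts_gauss_network)
  next
    case (Suc n)
    show ?case
    proof (cases "d = 0")
      case True
      then show ?thesis
        using Suc.prems by (intro exI[of _ "[]"]) (auto simp: awalk_Nil_iff verts_gauss_network)
    next
      case False
      obtain u where u: "u \<in> {1, -1, \<i>, -\<i>}" "l1 (d - u) = l1 d - 1"
        using Suc.prems(2) False by (rule l1_unit_step)
      then have ui: "u \<in> gauss_ints"
        by auto
      obtain p where p: "awalk (gauss_class \<alpha> (x + u)) p (gauss_class \<alpha> (x + u + (d - u)))"
        "length p \<le> n"
        using Suc.IH[of "x + u" "d - u"] u ui Suc.prems by auto
      have "(gauss_class \<alpha> x, gauss_class \<alpha> (x + u)) \<in> arcs (gauss_network \<alpha>)"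
        using gauss_class_arc_iff[OF \<alpha> Suc.prems(1), of "x + u"] u ui Suc.prems by blast
      then have "awalk (gauss_class \<alpha> x) ((gauss_class \<alpha> x, gauss_class \<alpha> (x + u)) # p)
          (gauss_class \<alpha> (x + d))"
        using p by (simp add: awalk_Cons_iff)
      then show ?thesis
        using p(2) by (metis Suc_le_mono length_Cons)
    qed
  }
qed

lemma graph_ball_gauss_network:
  assumes "\<alpha> \<in> gauss_ints" "x \<in> gauss_ints"
  shows "graph_ball (gauss_network \<alpha>) t (gauss_class \<alpha> x) =
    {gauss_class \<alpha> (x + d) | d. d \<in> gauss_ints \<and> l1 d \<le> real t}" (is "?B = ?D")
proof (rule Set.set_eqI)
  fix v
  have "v \<in> ?B \<longleftrightarrow> v \<in> gauss_class \<alpha> ` gauss_ints \<and>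
      (\<exists>p. pre_digraph.awalk (gauss_network \<alpha>) (gauss_class \<alpha> x) p v \<and> length p \<le> t)"
    by (simp add: graph_ball_def graph_dist_le_iff wf_digraph_gauss_network verts_gauss_network)
  also have "\<dots> \<longleftrightarrow> v \<in> ?D"
    using gauss_network_walk_shift[OF assms(1) _ assms(2)] gauss_network_walk_exists[OF assms]
      assms(2) by fastforce
  finally show "v \<in> ?B \<longleftrightarrow> v \<in> ?D" .
qed

section \<open>Perfect codes as covering and packing conditions\<close>

text \<open>As \<beta> divides \<alpha>, congruence modulo \<alpha> implies congruence modulo
  \<beta>, and the centres vanish modulo \<beta>; so only displacements within a ball remain.
  Packing ends in divisibility by \<alpha>, not in \<open>d = d'\<close>, because two centres
  coincide exactly when they agree modulo \<alpha>.\<close>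

lemma perfect_code_ideal_quot_iff:
  assumes \<alpha>: "\<alpha> \<in> gauss_ints" and \<beta>: "\<beta> \<in> gauss_ints" and dvd: "\<beta> dvd\<^sub>g \<alpha>"
  shows "perfect_code (gauss_network \<alpha>) t (ideal_quot \<beta> \<alpha>) \<longleftrightarrow>
    (\<forall>z\<in>gauss_ints. \<exists>d\<in>gauss_ints. l1 d \<le> real t \<and> \<beta> dvd\<^sub>g z - d) \<and>
    (\<forall>d\<in>gauss_ints. \<forall>d'\<in>gauss_ints. l1 d \<le> real t \<longrightarrow> l1 d' \<le> real t \<longrightarrow>
      \<beta> dvd\<^sub>g d - d' \<longrightarrow> \<alpha> dvd\<^sub>g d - d')"
    (is "_ \<longleftrightarrow> ?cover \<and> ?pack")
proof -
  let ?B = "graph_ball (gauss_network \<alpha>) t"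
  have code: "ideal_quot \<beta> \<alpha> = gauss_class \<alpha> ` {z \<in> gauss_ints. \<beta> dvd\<^sub>g z}"
    by (simp add: ideal_quot_def cgenideal_gauss_ring \<beta>)
  have dvd0: "\<beta> dvd\<^sub>g 0"
    by (force simp: gauss_dvd_iff)
  then have nonempty: "ideal_quot \<beta> \<alpha> \<noteq> {}"
    by (force simp: code)
  have sub: "ideal_quot \<beta> \<alpha> \<subseteq> verts (gauss_network \<alpha>)"
    by (auto simp: code verts_gauss_network)
  have "(\<Union>c\<in>ideal_quot \<beta> \<alpha>. ?B c) = verts (gauss_network \<alpha>) \<longleftrightarrow> ?cover"
  proof
    assume eq: "(\<Union>c\<in>ideal_quot \<beta> \<alpha>. ?B c) = verts (gauss_network \<alpha>)"
    show ?cover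
    proof
      fix z assume z: "z \<in> gauss_ints"
      then have "gauss_class \<alpha> z \<in> (\<Union>c\<in>ideal_quot \<beta> \<alpha>. ?B c)"
        by (simp add: eq verts_gauss_network)
      then obtain w d where w: "w \<in> gauss_ints" "\<beta> dvd\<^sub>g w" and d: "d \<in> gauss_ints" "l1 d \<le> real t"
        and "gauss_class \<alpha> z = gauss_class \<alpha> (w + d)"
        by (auto simp: code graph_ball_gauss_network \<alpha>)
      then have "\<alpha> dvd\<^sub>g z - (w + d)"
        using gauss_class_eq_iff \<alpha> z by auto
      then have "\<beta> dvd\<^sub>g (z - (w + d)) + w"
        using gauss_dvd_trans dvd gauss_dvd_add w by blast
      then show "\<exists>d\<in>gauss_ints. l1 d \<le> real t \<and> \<beta> dvd\<^sub>g z - d"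
        using d by (intro bexI[of _ d]) (auto simp: algebra_simps)
    qed
  next
    assume cover: ?cover
    show "(\<Union>c\<in>ideal_quot \<beta> \<alpha>. ?B c) = verts (gauss_network \<alpha>)"
    proof
      show "(\<Union>c\<in>ideal_quot \<beta> \<alpha>. ?B c) \<subseteq> verts (gauss_network \<alpha>)"
        by (auto simp: graph_ball_def)
    next
      show "verts (gauss_network \<alpha>) \<subseteq> (\<Union>c\<in>ideal_quot \<beta> \<alpha>. ?B c)"
      proof
        fix v assume "v \<in> verts (gauss_network \<alpha>)"
        then obtain z where z: "z \<in> gauss_ints" "v = gauss_class \<alpha> z"
          by (auto simp: verts_gauss_network)
        with cover obtain d where d: "d \<in> gauss_ints" "l1 d \<le> real t" "\<beta> dvd\<^sub>g z - d"
          by blast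
        have "v = gauss_class \<alpha> ((z - d) + d)"
          using z by simp
        then have "v \<in> ?B (gauss_class \<alpha> (z - d))"
          unfolding graph_ball_gauss_network[OF \<alpha> gauss_ints_closed(2)[OF z(1) d(1)]]
          using d by blast
        then show "v \<in> (\<Union>c\<in>ideal_quot \<beta> \<alpha>. ?B c)"
          using z d by (auto simp: code)
      qed
    qed
  qed
  moreover have "disjoint_family_on ?B (ideal_quot \<beta> \<alpha>) \<longleftrightarrow> ?pack"
  proof
    assume disj: "disjoint_family_on ?B (ideal_quot \<beta> \<alpha>)"
    show ?pack
    proof (intro ballI impI)
      fix d d' assume d: "d \<in> gauss_ints" "l1 d \<le> real t" and d': "d' \<in> gauss_ints" "l1 d' \<le> real t"
        and dd: "\<beta> dvd\<^sub>g d - d'"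
      \<comment> \<open>The class of \<open>d\<close> lies in the balls about 0 and about
        \<open>d - d'\<close>, both codewords, so disjointness identifies these two centres.\<close>
      have "gauss_class \<alpha> d \<in> ?B (gauss_class \<alpha> 0)"
        using d by (auto simp: graph_ball_gauss_network \<alpha>)
      moreover have "gauss_class \<alpha> ((d - d') + d') \<in> ?B (gauss_class \<alpha> (d - d'))"
        unfolding graph_ball_gauss_network[OF \<alpha> gauss_ints_closed(2)[OF d(1) d'(1)]]
        using d' by blast
      moreover have "gauss_class \<alpha> 0 \<in> ideal_quot \<beta> \<alpha>" "gauss_class \<alpha> (d - d') \<in> ideal_quot \<beta> \<alpha>"
        using dd d d' dvd0 by (auto simp: code)
      ultimately have "gauss_class \<alpha> (d - d') = gauss_class \<alpha> 0"
        using disj unfolding disjoint_family_on_def by fastforce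
      then show "\<alpha> dvd\<^sub>g d - d'"
        using d d' by (simp add: gauss_class_eq_iff \<alpha>)
    qed
  next
    assume pack: ?pack
    show "disjoint_family_on ?B (ideal_quot \<beta> \<alpha>)"
      unfolding disjoint_family_on_def
    proof (intro ballI impI, rule ccontr)
      fix c c' assume c: "c \<in> ideal_quot \<beta> \<alpha>" "c' \<in> ideal_quot \<beta> \<alpha>" and "c \<noteq> c'"
        and "?B c \<inter> ?B c' \<noteq> {}"
      then obtain v where v: "v \<in> ?B c" "v \<in> ?B c'"
        by blast
      from c obtain w w' where w: "w \<in> gauss_ints" "\<beta> dvd\<^sub>g w" "c = gauss_class \<alpha> w"
        and w': "w' \<in> gauss_ints" "\<beta> dvd\<^sub>g w'" "c' = gauss_class \<alpha> w'"
        by (auto simp: code)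
      from v w w' obtain d d' where d: "d \<in> gauss_ints" "l1 d \<le> real t"
        and d': "d' \<in> gauss_ints" "l1 d' \<le> real t"
        and "gauss_class \<alpha> (w + d) = gauss_class \<alpha> (w' + d')"
        by (auto simp: graph_ball_gauss_network \<alpha>)
      then have 1: "\<alpha> dvd\<^sub>g (w + d) - (w' + d')"
        using gauss_class_eq_iff \<alpha> w w' by auto
      \<comment> \<open>Modulo \<beta> the centres cancel and leave \<open>d - d'\<close>; packing
        makes this a multiple of \<alpha>, and removing it from the congruence identifies the
        centres.\<close>
      then have "\<beta> dvd\<^sub>g ((w + d) - (w' + d')) + (- w + w')"
        by (intro gauss_dvd_add[OF gauss_dvd_trans[OF dvd]] gauss_dvd_add gauss_dvd_uminus w w')
      then have "\<beta> dvd\<^sub>g d - d'"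
        by (simp add: algebra_simps)
      then have "\<alpha> dvd\<^sub>g - (d - d')"
        using pack d d' by (intro gauss_dvd_uminus) blast
      then have "\<alpha> dvd\<^sub>g ((w + d) - (w' + d')) + - (d - d')"
        by (rule gauss_dvd_add[OF 1])
      then have "\<alpha> dvd\<^sub>g w - w'"
        by (simp add: algebra_simps)
      then show False
        using \<open>c \<noteq> c'\<close> w w' gauss_class_eq_iff \<alpha> by auto
    qed
  qed
  ultimately show ?thesis
    using nonempty sub unfolding perfect_code_def by blast
qed

section \<open>Lower bounds for multiples of a Gaussian integer\<close>

text \<open>One coordinate of a product is free of cancellation, since \<open>- b * q * (a * p)\<close> and
  \<open>a * q * (b * p)\<close> have opposite signs.\<close>

lemma int_mult_norm_ge:
  fixes a b p q :: int
  assumes "p \<noteq> 0 \<or> q \<noteq> 0"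
  shows "\<bar>a\<bar> + \<bar>b\<bar> \<le> \<bar>a * p - b * q\<bar> + \<bar>a * q + b * p\<bar>"
    and "max \<bar>a\<bar> \<bar>b\<bar> \<le> max \<bar>a * p - b * q\<bar> \<bar>a * q + b * p\<bar>"
proof -
  have ge: "\<bar>x\<bar> \<le> \<bar>x * r\<bar>" if "r \<noteq> 0" for x r :: int
    using that mult_left_mono[of 1 "\<bar>r\<bar>" "\<bar>x\<bar>"] by (simp add: abs_mult)
  have same: "\<bar>x + y\<bar> = \<bar>x\<bar> + \<bar>y\<bar>" if "x * y \<ge> 0" for x y :: int
    using that by (auto simp: zero_le_mult_iff)
  have signs: "(a * p) * (- (b * q)) = - ((a * q) * (b * p))"
    by (simp add: algebra_simps)
  have nocancel: "\<bar>a * p - b * q\<bar> = \<bar>a * p\<bar> + \<bar>b * q\<bar> \<or> \<bar>a * q + b * p\<bar> = \<bar>a * q\<bar> + \<bar>b * p\<bar>"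
  proof (cases "(a * q) * (b * p) \<ge> 0")
    case True
    then show ?thesis using same by blast
  next
    case False
    then have "(a * p) * (- (b * q)) \<ge> 0"
      unfolding signs by simp
    then show ?thesis using same[of "a * p" "- (b * q)"] by simp
  qed
  \<comment> \<open>The coordinate without cancellation suffices alone, since \<open>p\<close> and
    \<open>q\<close> have absolute value at least 1.\<close>
  have large: "\<bar>a\<bar> + \<bar>b\<bar> \<le> \<bar>a * p - b * q\<bar> \<or> \<bar>a\<bar> + \<bar>b\<bar> \<le> \<bar>a * q + b * p\<bar>" if "p \<noteq> 0" "q \<noteq> 0"
    using nocancel add_mono[OF ge[OF that(1), of a] ge[OF that(2), of b]]
      add_mono[OF ge[OF that(2), of a] ge[OF that(1), of b]] by (elim disjE) simp_all
  consider "p = 0" "q \<noteq> 0" | "p \<noteq> 0" "q = 0" | "p \<noteq> 0" "q \<noteq> 0"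
    using assms by blast
  then have "\<bar>a\<bar> + \<bar>b\<bar> \<le> \<bar>a * p - b * q\<bar> + \<bar>a * q + b * p\<bar> \<and>
    max \<bar>a\<bar> \<bar>b\<bar> \<le> max \<bar>a * p - b * q\<bar> \<bar>a * q + b * p\<bar>"
  proof cases
    case 1
    then show ?thesis
      using ge[of q a] ge[of q b] by (simp add: max_def)
  next
    case 2
    then show ?thesis
      using ge[of p a] ge[of p b] by (simp add: max_def)
  next
    case 3
    have "K \<le> P + Q \<and> max A B \<le> max P Q"
      if "K \<le> P \<or> K \<le> Q" "K = A + B" "0 \<le> A" "0 \<le> B" "0 \<le> P" "0 \<le> Q" for A B K P Q :: int
      using that by (auto simp: max_def)
    from this[OF large[OF 3] refl] show ?thesis
      by simp
  qed
  then show "\<bar>a\<bar> + \<bar>b\<bar> \<le> \<bar>a * p - b * q\<bar> + \<bar>a * q + b * p\<bar>"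
    "max \<bar>a\<bar> \<bar>b\<bar> \<le> max \<bar>a * p - b * q\<bar> \<bar>a * q + b * p\<bar>"
    by blast+
qed

text \<open>Used for both generators: for \<alpha> it excludes a short \<beta>, and for \<beta> it
  separates the balls.\<close>

lemma l1_le_if_gauss_dvd:
  assumes "x \<in> gauss_ints" "x dvd\<^sub>g z" "z \<noteq> 0"
  shows "l1 x \<le> l1 z"
proof -
  from assms obtain m where m: "m \<in> gauss_ints" "z = x * m"
    by (auto simp: gauss_dvd_iff)
  obtain a b where x: "x = Complex (of_int a) (of_int b)"
    using assms(1) by (rule gauss_ints_cases)
  obtain p q where pq: "m = Complex (of_int p) (of_int q)"
    using m(1) by (rule gauss_ints_cases)
  have "p \<noteq> 0 \<or> q \<noteq> 0"
    using assms(3) m pq by (auto simp: complex_eq_iff)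
  from int_mult_norm_ge(1)[OF this, of a b]
  have "real_of_int (\<bar>a\<bar> + \<bar>b\<bar>) \<le> real_of_int (\<bar>a * p - b * q\<bar> + \<bar>a * q + b * p\<bar>)"
    by (simp only: of_int_le_iff)
  then show ?thesis
    by (simp add: l1_def m x pq)
qed

section \<open>Covering by balls and differences within a ball\<close>

text \<open>The pairs are the associates of \<beta>, one in each closed quadrant. Off the axes, the
  associate in the quadrant of \<open>(x, y)\<close> works: overshooting both coordinates changes
  the norm by \<open>2 * t + 1 - 2 * (\<bar>x\<bar> + \<bar>y\<bar>)\<close>, which is negative, and
  overshooting one changes it by at most 1 - 2. On an axis, take the associate with its entry of
  size \<open>t + 1\<close> pointing along it; the norm drops by 1.\<close>

lemma l1_ball_cover_step:
  fixes c d t x y :: int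
  assumes "\<bar>c\<bar> = t \<and> \<bar>d\<bar> = t + 1 \<or> \<bar>c\<bar> = t + 1 \<and> \<bar>d\<bar> = t" and "\<bar>x\<bar> + \<bar>y\<bar> > t"
  shows "\<exists>(v, w)\<in>{(c, d), (- c, - d), (- d, c), (d, - c)}. \<bar>x - v\<bar> + \<bar>y - w\<bar> < \<bar>x\<bar> + \<bar>y\<bar>"
proof -
  have "\<bar>x - c\<bar> + \<bar>y - d\<bar> < \<bar>x\<bar> + \<bar>y\<bar> \<or> \<bar>x + c\<bar> + \<bar>y + d\<bar> < \<bar>x\<bar> + \<bar>y\<bar> \<or>
      \<bar>x + d\<bar> + \<bar>y - c\<bar> < \<bar>x\<bar> + \<bar>y\<bar> \<or> \<bar>x - d\<bar> + \<bar>y + c\<bar> < \<bar>x\<bar> + \<bar>y\<bar>"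
    using assms by (smt (verit))
  then show ?thesis
    by simp
qed

lemma l1_ball_cover:
  fixes t :: nat
  assumes \<beta>: "\<beta> = Complex (of_int c) (of_int d)"
    and cd: "\<bar>c\<bar> = int t \<and> \<bar>d\<bar> = int t + 1 \<or> \<bar>c\<bar> = int t + 1 \<and> \<bar>d\<bar> = int t"
    and "z \<in> gauss_ints"
  shows "\<exists>e\<in>gauss_ints. l1 e \<le> real t \<and> \<beta> dvd\<^sub>g z - e"
  using \<open>z \<in> gauss_ints\<close>
\<comment> \<open>Descent on the norm, which is an integer here; the floor only supplies the
  type.\<close>
proof (induction "nat \<lfloor>l1 z\<rfloor>" arbitrary: z rule: less_induct)
  case less
  show ?case
  proof (cases "l1 z \<le> real t")
    case True
    then show ?thesis
      using less.prems by (intro bexI[of _ z]) (auto simp: gauss_dvd_iff intro!: bexI[of _ 0])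
  next
    case False
    obtain x y where z: "z = Complex (of_int x) (of_int y)"
      using less.prems by (rule gauss_ints_cases)
    have "\<bar>x\<bar> + \<bar>y\<bar> > int t"
      using False z by (simp add: l1_def)
    from l1_ball_cover_step[OF cd this] obtain v w where vw: "(v, w) \<in> {(c, d), (- c, - d), (- d, c), (d, - c)}"
      "\<bar>x - v\<bar> + \<bar>y - w\<bar> < \<bar>x\<bar> + \<bar>y\<bar>"
      by (elim bexE case_prodE) simp
    let ?s = "Complex (of_int v) (of_int w)"
    have "?s \<in> {\<beta> * 1, \<beta> * (-1), \<beta> * \<i>, \<beta> * (-\<i>)}"
      using vw(1) by (auto simp: \<beta> complex_eq_iff)
    then have s: "\<beta> dvd\<^sub>g ?s"
      unfolding gauss_dvd_iff using gauss_ints_units by blast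
    have l1_eq: "l1 (z - ?s) = of_int (\<bar>x - v\<bar> + \<bar>y - w\<bar>)" "l1 z = of_int (\<bar>x\<bar> + \<bar>y\<bar>)"
      by (simp_all add: l1_def z)
    have "nat \<lfloor>l1 (z - ?s)\<rfloor> < nat \<lfloor>l1 z\<rfloor>"
      unfolding l1_eq floor_of_int using vw(2) by (subst nat_less_eq_zless) auto
    then obtain e where e: "e \<in> gauss_ints" "l1 e \<le> real t" "\<beta> dvd\<^sub>g (z - ?s) - e"
      using less.hyps[of "z - ?s"] less.prems by auto
    then have "\<beta> dvd\<^sub>g ((z - ?s) - e) + ?s"
      using s gauss_dvd_add by blast
    then show ?thesis
      using e by (intro bexI[of _ e]) (auto simp: algebra_simps)
  qed
qed

text \<open>Halve a grid path from 0 to \<open>z\<close>. Applied to \<beta>, this shows that a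
  short \<beta> would violate packing.\<close>

lemma l1_ball_diff:
  assumes "z \<in> gauss_ints" "l1 z \<le> 2 * real t"
  obtains d d' where "d \<in> gauss_ints" "d' \<in> gauss_ints" "l1 d \<le> real t" "l1 d' \<le> real t" "z = d - d'"
proof -
  \<comment> \<open>Separating the two radii allows induction on one with the other fixed.\<close>
  have "\<exists>d\<in>gauss_ints. l1 d \<le> real t \<and> l1 (z - d) \<le> real n"
    if "z \<in> gauss_ints" "l1 z \<le> real t + real n" for n z
    using that
  proof (induction n arbitrary: z)
    case 0
    then show ?case
      by (intro bexI[of _ z]) (auto simp: l1_def)
  next
    case (Suc n)
    show ?case
    proof (cases "z = 0")
      case True
      then show ?thesis
        by (intro bexI[of _ 0]) (auto simp: l1_def)
    next
      case False
      obtain u where u: "u \<in> {1, -1, \<i>, -\<i>}" "l1 (z - u) = l1 z - 1"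
        using Suc.prems(1) False by (rule l1_unit_step)
      then have "u \<in> gauss_ints"
        by auto
      then obtain d where d: "d \<in> gauss_ints" "l1 d \<le> real t" "l1 (z - u - d) \<le> real n"
        using Suc.IH[of "z - u"] Suc.prems u by auto
      then show ?thesis
        using l1_triangle[of "z - u - d" u] l1_unit[OF u(1)]
        by (intro bexI[of _ d]) (auto simp: algebra_simps)
    qed
  qed
  from this[OF assms(1), of t] assms obtain d where
    "d \<in> gauss_ints" "l1 d \<le> real t" "l1 (z - d) \<le> real t"
    by auto
  then show thesis
    using assms(1) that[of d "d - z"] by (auto simp: l1_def abs_minus_commute)
qed

text \<open>Cover the integer point nearest to the deep hole \<open>\<beta> * (1 + \<i>) / 2\<close>: twice the
  difference between the hole and a multiple of \<open>\<beta>\<close> is a nonzero multiple of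
  \<open>\<beta> * (1 + \<i>)\<close>.\<close>

lemma sup_norm_le_if_cover:
  fixes c d :: int and t :: nat
  assumes \<beta>: "\<beta> = Complex (of_int c) (of_int d)"
    and cover: "\<And>z. z \<in> gauss_ints \<Longrightarrow> \<exists>e\<in>gauss_ints. l1 e \<le> real t \<and> \<beta> dvd\<^sub>g z - e"
  shows "max \<bar>c\<bar> \<bar>d\<bar> \<le> int t + (c + d) mod 2"
proof -
  \<comment> \<open>The hole has coordinates \<open>(c - d) / 2\<close> and
    \<open>(c + d) / 2\<close>; both are rounded down.\<close>
  define z where "z = Complex (of_int ((c - d) div 2)) (of_int ((c + d) div 2))"
  obtain e m where e: "e \<in> gauss_ints" "l1 e \<le> real t" and m: "m \<in> gauss_ints" "z - e = \<beta> * m"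
    using cover[of z] by (auto simp: z_def gauss_dvd_iff)
  obtain x y where xy: "e = Complex (of_int x) (of_int y)"
    using e(1) by (rule gauss_ints_cases)
  obtain p q where pq: "m = Complex (of_int p) (of_int q)"
    using m(1) by (rule gauss_ints_cases)
  have "real_of_int (\<bar>x\<bar> + \<bar>y\<bar>) \<le> real_of_int (int t)"
    using e(2) xy by (simp add: l1_def)
  then have xy_le: "\<bar>x\<bar> + \<bar>y\<bar> \<le> int t"
    by (simp only: of_int_le_iff)
  have "real_of_int ((c - d) div 2 - x) = real_of_int (c * p - d * q)"
    "real_of_int ((c + d) div 2 - y) = real_of_int (c * q + d * p)"
    using m(2) by (simp_all add: z_def xy pq \<beta> complex_eq_iff)
  then have eqs: "(c - d) div 2 - x = c * p - d * q" "(c + d) div 2 - y = c * q + d * p"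
    by (simp_all only: of_int_eq_iff)
  \<comment> \<open>With \<open>m = p + q \<i>\<close>, one has
    \<open>r + s \<i> = 1 - (1 - \<i>) m\<close>, the cofactor in \<open>\<beta> (1 + \<i>) - 2
    \<beta> m = \<beta> (1 + \<i>) (r + s \<i>)\<close>. It is nonzero because
    \<open>r + s = 1 - 2 q\<close> is odd.\<close>
  define r s where "r = 1 - p - q" and "s = p - q"
  have "r \<noteq> 0 \<or> s \<noteq> 0"
    unfolding r_def s_def by presburger
  then have "max \<bar>c\<bar> \<bar>d\<bar> \<le> max \<bar>c * r - d * s\<bar> \<bar>c * s + d * r\<bar>"
    by (rule int_mult_norm_ge(2))
  moreover have "c * r - d * s = (c - (c * p - d * q)) - (c * q + d * p)"
    "c * s + d * r = (c * p - d * q) - (c * q + d * p) + d"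
    by (simp_all add: r_def s_def algebra_simps)
  ultimately have "max \<bar>c\<bar> \<bar>d\<bar> \<le>
      max \<bar>c - ((c - d) div 2 - x) - ((c + d) div 2 - y)\<bar>
        \<bar>((c - d) div 2 - x) - ((c + d) div 2 - y) + d\<bar>"
    unfolding eqs by simp
  \<comment> \<open>The rounding errors add up to the parity of \<open>c + d\<close> in one
    coordinate and cancel in the other.\<close>
  moreover have "c - (c - d) div 2 - (c + d) div 2 = (c + d) mod 2"
    "(c - d) div 2 - (c + d) div 2 + d = 0"
    by presburger+
  moreover have "(c + d) mod 2 \<ge> 0"
    by simp
  ultimately show ?thesis
    using xy_le by (smt (verit))
qed

section \<open>Associates and the characterization of perfect codes\<close>

lemma imaginary_unit_powi: "\<i> powi j \<in> {1, -1, \<i>, -\<i>}"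
proof -
  have "\<i> powi j = \<i> powi (4 * (j div 4) + j mod 4)"
    by simp
  also have "\<dots> = (\<i> powi 4) powi (j div 4) * \<i> powi (j mod 4)"
    by (subst power_int_add) (auto simp: power_int_mult)
  also have "\<i> powi 4 = 1"
    by (simp add: power_int_def eval_nat_numeral)
  finally have "\<i> powi j = \<i> powi (j mod 4)"
    by simp
  moreover have "j mod 4 \<in> {0, 1, 2, 3}"
    by auto
  ultimately show ?thesis
    by (auto simp: power_int_def eval_nat_numeral)
qed

lemma gauss_assoc_iff: "gauss_assoc x y \<longleftrightarrow> x = y \<or> x = - y \<or> x = \<i> * y \<or> x = - \<i> * y"
proof
  assume "gauss_assoc x y"
  then obtain j where "x = \<i> powi j * y"
    unfolding gauss_assoc_def by blast
  then show "x = y \<or> x = - y \<or> x = \<i> * y \<or> x = - \<i> * y"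
    using imaginary_unit_powi[of j] by auto
next
  have "y = \<i> powi 0 * y" "- y = \<i> powi 2 * y" "\<i> * y = \<i> powi 1 * y" "- \<i> * y = \<i> powi 3 * y"
    by (simp_all add: power_int_def eval_nat_numeral)
  moreover assume "x = y \<or> x = - y \<or> x = \<i> * y \<or> x = - \<i> * y"
  ultimately show "gauss_assoc x y"
    unfolding gauss_assoc_def by blast
qed

text \<open>The two given numbers are conjugate. Quarter turns of both produce every choice of signs
  and order of the coordinates.\<close>

lemma gauss_assoc_consecutive_iff:
  fixes c d :: int and t :: nat
  assumes "\<beta> = Complex (of_int c) (of_int d)"
  shows "gauss_assoc \<beta> (of_nat t + (of_nat t + 1) * \<i>) \<or> gauss_assoc \<beta> (of_nat t - (of_nat t + 1) * \<i>)
    \<longleftrightarrow> \<bar>c\<bar> = int t \<and> \<bar>d\<bar> = int t + 1 \<or> \<bar>c\<bar> = int t + 1 \<and> \<bar>d\<bar> = int t"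
proof -
  have "real_of_int x = real t \<longleftrightarrow> x = int t" "real_of_int x = - real t \<longleftrightarrow> x = - int t"
    "real_of_int x = real t + 1 \<longleftrightarrow> x = int t + 1" "real_of_int x = - 1 - real t \<longleftrightarrow> x = - 1 - int t"
    for x :: int
    by linarith+
  then show ?thesis
    by (simp add: gauss_assoc_iff assms complex_eq_iff) (auto simp: abs_if split: if_splits)
qed

theorem theorem4p5:
  fixes a b :: int and \<alpha> \<beta> :: complex and t :: nat
  assumes "\<alpha> = of_int a + of_int b * \<i>" and "a \<ge> 0" and "b \<ge> 0" and "\<alpha> \<noteq> 0"
    and "\<beta> \<in> carrier gauss_ring" and "\<beta> \<noteq> 0"
    and "gauss_norm \<alpha> \<ge> 5"
    and "\<beta> divides\<^bsub>gauss_ring\<^esub> \<alpha>"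
    and "1 \<le> t" and "int t \<le> \<lfloor>real_of_int (a + b - 1) / 2\<rfloor>"
  shows "perfect_code (gauss_network \<alpha>) t (ideal_quot \<beta> \<alpha>) \<longleftrightarrow>
    gauss_assoc \<beta> (of_nat t + (of_nat t + 1) * \<i>) \<or>
    gauss_assoc \<beta> (of_nat t - (of_nat t + 1) * \<i>)"
proof -
  have \<alpha>: "\<alpha> \<in> gauss_ints"
    using assms(1) by (simp add: gauss_ints_iff)
  \<comment> \<open>Since \<open>a\<close> and \<open>b\<close> are nonnegative,
    \<open>l1 \<alpha>\<close> is \<open>a + b\<close>, and the floor bound on \<open>t\<close>
    unfolds to this.\<close>
  have l1_\<alpha>: "2 * real t + 1 \<le> l1 \<alpha>"
    using assms(1,2,3,10) by (simp add: l1_def le_floor_iff)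
  obtain c d where cd: "\<beta> = Complex (of_int c) (of_int d)"
    using assms(5) by (rule gauss_ints_cases)
  have l1_\<beta>: "l1 \<beta> = of_int (\<bar>c\<bar> + \<bar>d\<bar>)"
    by (simp add: cd l1_def)
  show ?thesis
    unfolding perfect_code_ideal_quot_iff[OF \<alpha> assms(5,8)] gauss_assoc_consecutive_iff[OF cd]
  proof (intro iffI conjI ballI impI; (elim conjE)?)
    assume cover: "\<forall>z\<in>gauss_ints. \<exists>e\<in>gauss_ints. l1 e \<le> real t \<and> \<beta> dvd\<^sub>g z - e"
      and pack: "\<forall>e\<in>gauss_ints. \<forall>e'\<in>gauss_ints. l1 e \<le> real t \<longrightarrow> l1 e' \<le> real t \<longrightarrow>
        \<beta> dvd\<^sub>g e - e' \<longrightarrow> \<alpha> dvd\<^sub>g e - e'"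
    \<comment> \<open>Otherwise \<beta> is a difference of two points of the ball, so packing makes
      \<alpha> divide \<beta>, although \<open>l1 \<alpha>\<close> is larger.\<close>
    have "\<not> l1 \<beta> \<le> 2 * real t"
    proof
      assume le: "l1 \<beta> \<le> 2 * real t"
      with assms(5) obtain e e' where "e \<in> gauss_ints" "e' \<in> gauss_ints"
        "l1 e \<le> real t" "l1 e' \<le> real t" "\<beta> = e - e'"
        by (rule l1_ball_diff)
      moreover have "\<beta> dvd\<^sub>g \<beta>"
        by (auto simp: gauss_dvd_iff intro!: bexI[of _ 1])
      ultimately have "\<alpha> dvd\<^sub>g \<beta>"
        using pack by blast
      then show False
        using l1_le_if_gauss_dvd[OF \<alpha> _ assms(6)] l1_\<alpha> le by simp
    qed
    then have "\<bar>c\<bar> + \<bar>d\<bar> \<ge> 2 * int t + 1"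
      unfolding l1_\<beta> by linarith
    moreover have "even (\<bar>c\<bar> + \<bar>d\<bar>) \<longleftrightarrow> (c + d) mod 2 = 0" "(c + d) mod 2 \<le> 1"
      by (auto simp: even_iff_mod_2_eq_zero[symmetric])
    \<comment> \<open>For even \<open>c + d\<close> the maximum is at most \<open>t\<close>, too
      small for a sum of \<open>2 * t + 1\<close>. This also excludes both absolute values being
      \<open>t + 1\<close>, the only other case within the odd bound.\<close>
    then have "\<bar>c\<bar> + \<bar>d\<bar> = 2 * (int t + 1) \<Longrightarrow> (c + d) mod 2 = 0" "(c + d) mod 2 \<le> 1"
      by (metis dvd_triv_left, blast)
    moreover have "max \<bar>c\<bar> \<bar>d\<bar> \<le> int t + (c + d) mod 2"
      using cd cover by (intro sup_norm_le_if_cover) auto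
    ultimately show "\<bar>c\<bar> = int t \<and> \<bar>d\<bar> = int t + 1 \<or> \<bar>c\<bar> = int t + 1 \<and> \<bar>d\<bar> = int t"
      by (smt (verit))
  next
    fix z assume "\<bar>c\<bar> = int t \<and> \<bar>d\<bar> = int t + 1 \<or> \<bar>c\<bar> = int t + 1 \<and> \<bar>d\<bar> = int t" "z \<in> gauss_ints"
    then show "\<exists>e\<in>gauss_ints. l1 e \<le> real t \<and> \<beta> dvd\<^sub>g z - e"
      by (rule l1_ball_cover[OF cd])
  next
    fix e e' assume "\<bar>c\<bar> = int t \<and> \<bar>d\<bar> = int t + 1 \<or> \<bar>c\<bar> = int t + 1 \<and> \<bar>d\<bar> = int t"
      and "e \<in> gauss_ints" "e' \<in> gauss_ints" and e: "l1 e \<le> real t" "l1 e' \<le> real t"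
      and dvd: "\<beta> dvd\<^sub>g e - e'"
    then have "\<bar>c\<bar> + \<bar>d\<bar> = 2 * int t + 1"
      by auto
    \<comment> \<open>A difference within the ball has norm at most \<open>2 * t\<close>, below that
      of any nonzero multiple of \<beta>.\<close>
    then have "l1 \<beta> > l1 (e - e')"
      using e l1_triangle_diff[of e e'] unfolding l1_\<beta> by linarith
    then have "e - e' = 0"
      using l1_le_if_gauss_dvd[OF assms(5) dvd] by force
    then show "\<alpha> dvd\<^sub>g e - e'"
      by (force simp: gauss_dvd_iff)
  qed
qed

end
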